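(* For the stable modified Jackson network described in the context, among the jitter and bridge paths we have $$\inf_{p\in F_x}I(p)=\theta_1^j .$$ Furthermore, the following conditions are equivalent: 1. $\theta^j<\theta^b$ (componentwise); 2. a jitter path is optimal in $F_x$; 3. $\beta<1$, where $\beta$ is the value of the mixing parameter at the optimum over $F_x$; 4. $M^-(\theta^b)>0$; 5. $\rho<1$, where $$\rho=\frac{\bar\lambda_2e^{\theta_2^j}+\mu_1r_{1,2}e^{-\theta_1^j+\theta_2^j}}{\mu_2r_{2,0}e^{-\theta_2^j}+\mu_2r_{2,1}e^{\theta_1^j-\theta_2^j}}.$$
   Context: **Network parameters.** $\bar\lambda_1,\bar\lambda_2\ge 0$; $\mu_1,\mu_2>0$; $\mu_1^*\ge\mu_1$; $r_{1,2},r_{2,1}\in[0,1]$ with $r_{1,2}r_{2,1}<1$; $r_{1,0}=1-r_{1,2}$, $r_{2,0}=1-r_{2,1}$. Let $(\lambda_1,\lambda_2)$ be the unique solution of $\lambda_1=\bar\lambda_1+\lambda_2r_{2,1}$, $\lambda_2=\bar\lambda_2+\lambda_1r_{1,2}$; assume $\lambda_1,\lambda_2>0$. Put $\rho_i=\lambda_i/\mu_i$. (These are the parameters of a two-node Jackson network, with exogenous arrival rates $\bar\lambda_i$, service rates $\mu_i$ and routing probabilities $r_{i,j}$, modified so that the service rate at node 1 is $\mu_1^*$ when queue 2 is empty.) The network is assumed stable: $\rho_2<1$ and $\lambda_1<\rho_2\mu_1+(1-\rho_2)\mu_1^*$. **Rate functions.** Let $$M^+(\theta_1,\theta_2)=\bar\lambda_1(e^{\theta_1}-1)+\bar\lambda_2(e^{\theta_2}-1)+\mu_1r_{1,0}(e^{-\theta_1}-1)+\mu_1r_{1,2}(e^{\theta_2-\theta_1}-1)+\mu_2r_{2,0}(e^{-\theta_2}-1)+\mu_2r_{2,1}(e^{\theta_1-\theta_2}-1),$$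 $$M^-(\theta_1,\theta_2)=\bar\lambda_1(e^{\theta_1}-1)+\bar\lambda_2(e^{\theta_2}-1)+\mu_1^*r_{1,0}(e^{-\theta_1}-1)+\mu_1^*r_{1,2}(e^{\theta_2-\theta_1}-1),$$ $\Lambda^\pm(\vec v)=\sup_{\theta\in\mathbb R^2}(\theta_1v_1+\theta_2v_2-M^\pm(\theta))$, and, with the convention $0\cdot\infty=0$, $$\Lambda^*(v_1,0)=\inf\{\beta\Lambda^+(\vec v^+)+(1-\beta)\Lambda^-(\vec v^-):0\le\beta\le1,\ \beta\vec v^++(1-\beta)\vec v^-=(v_1,0)\}.$$ **Paths.** $F_x$ is the set of constant speed paths along the $x$-axis: $p(s)=(v_1s,0)$, $v_1>0$, until hitting $(1,0)$ at time $1/v_1$, then following the zero-cost drift path to the origin. The action of such a path is $I(p)=\Lambda^*(v_1,0)/v_1$. Hence $\inf_{p\in F_x}I(p)$ is the infimum of $(\beta\Lambda^+(\vec v^+)+(1-\beta)\Lambda^-(\vec v^-))/v_1$ over $v_1>0$, $0\le\beta\le1$, $\vec v^\pm\in\mathbb R^2$ with $\beta\vec v^++(1-\beta)\vec v^-=(v_1,0)$. The $\beta$ in condition 3 is the value of $\beta$ at a minimizer of this problem. A path in $F_x$ is a *jitter path* when the corresponding $\beta$ is $<1$ (nonzero proportion of time $1-\beta$ on the axis) and a *bridge path* when $\beta=1$. **The points $\theta^b,\theta^j$.** $\theta^b=(\theta_1^b,\theta_2^b)$ is the unique solution of $\theta_1>0$, $\partial M^+/\partial\theta_2(\theta)=0$,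 $M^+(\theta)=0$ (the easternmost point of the closed curve $M^+=0$). $\theta^j=(\theta_1^j,\theta_2^j)$ is the (at most one) point with $\theta_1>0$, $M^+(\theta)=M^-(\theta)=0$ and $\partial M^+/\partial\theta_2(\theta)<0$ (i.e. the intersection of $M^-=0$ with the arc of $M^+=0$ going clockwise from $\theta^b$ to the $\theta_1$-axis, excluding $\theta^b$ and the origin) if such a point exists; otherwise $\theta^j=\theta^b$. *)

theory Defs
  imports "HOL-Analysis.Analysis"
begin

text \<open>
  Two-node Jackson network with exogenous arrival rates \<open>arr1\<close>, \<open>arr2\<close>, service rates
  \<open>serv1\<close>, \<open>serv2\<close>, routing probabilities \<open>route12\<close>, \<open>route21\<close>, and service rate
  \<open>serv1_star\<close> at node 1 while queue 2 is empty. Parameter constraints are assumed where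
  they are used.
\<close>

record jackson_network =
  arr1 :: real
  arr2 :: real
  serv1 :: real
  serv2 :: real
  serv1_star :: real
  route12 :: real
  route21 :: real

definition exit1 :: "jackson_network \<Rightarrow> real" where
  "exit1 N = 1 - route12 N"

definition exit2 :: "jackson_network \<Rightarrow> real" where
  "exit2 N = 1 - route21 N"

definition M_plus :: "jackson_network \<Rightarrow> real \<times> real \<Rightarrow> real" where
  "M_plus N = (\<lambda>(\<theta>1, \<theta>2).
       arr1 N * (exp \<theta>1 - 1) + arr2 N * (exp \<theta>2 - 1)
     + serv1 N * exit1 N * (exp (- \<theta>1) - 1) + serv1 N * route12 N * (exp (\<theta>2 - \<theta>1) - 1)
     + serv2 N * exit2 N * (exp (- \<theta>2) - 1) + serv2 N * route21 N * (exp (\<theta>1 - \<theta>2) - 1))"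

definition M_minus :: "jackson_network \<Rightarrow> real \<times> real \<Rightarrow> real" where
  "M_minus N = (\<lambda>(\<theta>1, \<theta>2).
       arr1 N * (exp \<theta>1 - 1) + arr2 N * (exp \<theta>2 - 1)
     + serv1_star N * exit1 N * (exp (- \<theta>1) - 1)
     + serv1_star N * route12 N * (exp (\<theta>2 - \<theta>1) - 1))"

text \<open>
  The inner product on \<open>real \<times> real\<close> is the standard one. The supremum may be infinite (for
  \<open>M_minus\<close> it is whenever the second component of \<open>v\<close> is negative), hence the type \<open>ereal\<close>.
\<close>

definition legendre :: "(real \<times> real \<Rightarrow> real) \<Rightarrow> real \<times> real \<Rightarrow> ereal" where
  "legendre M v = (SUP \<theta>. ereal (\<theta> \<bullet> v - M \<theta>))"

definition Lambda_plus :: "jackson_network \<Rightarrow> real \<times> real \<Rightarrow> ereal" where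
  "Lambda_plus N = legendre (M_plus N)"

definition Lambda_minus :: "jackson_network \<Rightarrow> real \<times> real \<Rightarrow> ereal" where
  "Lambda_minus N = legendre (M_minus N)"

text \<open>Multiplication on \<open>ereal\<close> satisfies \<open>0 * \<infinity> = 0\<close>, which is the convention wanted here.\<close>

definition mix_cost ::
  "jackson_network \<Rightarrow> real \<Rightarrow> real \<times> real \<Rightarrow> real \<times> real \<Rightarrow> ereal" where
  "mix_cost N \<beta> vp vm = ereal \<beta> * Lambda_plus N vp + ereal (1 - \<beta>) * Lambda_minus N vm"

definition mixture :: "real \<times> real \<Rightarrow> real \<Rightarrow> real \<times> real \<Rightarrow> real \<times> real \<Rightarrow> bool" where
  "mixture v \<beta> vp vm \<longleftrightarrow> 0 \<le> \<beta> \<and> \<beta> \<le> 1 \<and> \<beta> *\<^sub>R vp + (1 - \<beta>) *\<^sub>R vm = v"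

text \<open>Meaningful as a rate function only for velocities \<open>(v1, 0)\<close> along the axis.\<close>

definition Lambda_star :: "jackson_network \<Rightarrow> real \<times> real \<Rightarrow> ereal" where
  "Lambda_star N v = Inf {mix_cost N \<beta> vp vm | \<beta> vp vm. mixture v \<beta> vp vm}"

text \<open>
  A path in \<open>F_x\<close> is represented by its leg from the origin to \<open>(1, 0)\<close>, traversed with constant
  speed during the time interval \<open>[0, 1 / v]\<close>. The subsequent leg back to the origin follows
  the drift at zero cost and does not enter the action.
\<close>

definition x_path :: "real \<Rightarrow> real \<Rightarrow> real \<times> real" where
  "x_path v = (\<lambda>s\<in>{0..1 / v}. (v * s, 0))"

definition F_x :: "(real \<Rightarrow> real \<times> real) set" where
  "F_x = {x_path v | v. 0 < v}"

definition x_speed :: "(real \<Rightarrow> real \<times> real) \<Rightarrow> real" where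
  "x_speed p = (THE v. 0 < v \<and> p = x_path v)"

lemma x_speed_x_path:
  assumes "0 < v"
  shows "x_speed (x_path v) = v"
  unfolding x_speed_def
proof (rule the_equality)
  show "0 < v \<and> x_path v = x_path v"
    using assms by simp
next
  fix w :: real
  assume w: "0 < w \<and> x_path v = x_path w"
  define s where "s = min (1 / v) (1 / w)"
  have s: "0 < s" "s \<in> {0..1 / v}" "s \<in> {0..1 / w}"
    using assms w by (auto simp: s_def)
  have "x_path v s = x_path w s"
    using w by simp
  then have "v * s = w * s"
    using s unfolding x_path_def by simp
  then show "w = v"
    using s by simp
qed

definition path_action :: "jackson_network \<Rightarrow> (real \<Rightarrow> real \<times> real) \<Rightarrow> ereal" where
  "path_action N p = Lambda_star N (x_speed p, 0) / ereal (x_speed p)"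

text \<open>
  The parameter \<open>\<beta>\<close> belonging to a path is one that attains the infimum defining
  \<open>Lambda_star\<close> at the velocity of the path.
\<close>

definition path_mixing :: "jackson_network \<Rightarrow> (real \<Rightarrow> real \<times> real) \<Rightarrow> real \<Rightarrow> bool" where
  "path_mixing N p \<beta> \<longleftrightarrow>
     (\<exists>vp vm. mixture (x_speed p, 0) \<beta> vp vm \<and>
              mix_cost N \<beta> vp vm = Lambda_star N (x_speed p, 0))"

definition jitter_path :: "jackson_network \<Rightarrow> (real \<Rightarrow> real \<times> real) \<Rightarrow> bool" where
  "jitter_path N p \<longleftrightarrow> p \<in> F_x \<and> (\<exists>\<beta> < 1. path_mixing N p \<beta>)"

definition optimal_path :: "jackson_network \<Rightarrow> (real \<Rightarrow> real \<times> real) \<Rightarrow> bool" where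
  "optimal_path N p \<longleftrightarrow> p \<in> F_x \<and> (\<forall>q\<in>F_x. path_action N p \<le> path_action N q)"

text \<open>Minimizers of the joint problem over speed, mixing parameter and the two velocities.\<close>

definition minimizer ::
  "jackson_network \<Rightarrow> real \<Rightarrow> real \<Rightarrow> real \<times> real \<Rightarrow> real \<times> real \<Rightarrow> bool" where
  "minimizer N v1 \<beta> vp vm \<longleftrightarrow>
     0 < v1 \<and> mixture (v1, 0) \<beta> vp vm \<and>
     (\<forall>v1' \<beta>' vp' vm'. 0 < v1' \<and> mixture (v1', 0) \<beta>' vp' vm' \<longrightarrow>
        mix_cost N \<beta> vp vm / ereal v1 \<le> mix_cost N \<beta>' vp' vm' / ereal v1')"

text \<open>
  All minimizers of a stable network share the same \<open>\<beta>\<close>; the velocity \<open>vm\<close> is not unique,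
  as it is unconstrained when \<open>\<beta> = 1\<close>.
\<close>

definition beta_opt :: "jackson_network \<Rightarrow> real" where
  "beta_opt N = (THE \<beta>. \<exists>v1 vp vm. minimizer N v1 \<beta> vp vm)"

definition partial2 :: "(real \<times> real \<Rightarrow> real) \<Rightarrow> real \<times> real \<Rightarrow> real" where
  "partial2 f \<theta> = deriv (\<lambda>t. f (fst \<theta>, t)) (snd \<theta>)"

definition theta_b :: "jackson_network \<Rightarrow> real \<times> real" where
  "theta_b N = (THE \<theta>. 0 < fst \<theta> \<and> partial2 (M_plus N) \<theta> = 0 \<and> M_plus N \<theta> = 0)"

definition is_jitter_point :: "jackson_network \<Rightarrow> real \<times> real \<Rightarrow> bool" where
  "is_jitter_point N \<theta> \<longleftrightarrow>
     0 < fst \<theta> \<and> M_plus N \<theta> = 0 \<and> M_minus N \<theta> = 0 \<and> partial2 (M_plus N) \<theta> < 0"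

definition theta_j :: "jackson_network \<Rightarrow> real \<times> real" where
  "theta_j N = (if \<exists>\<theta>. is_jitter_point N \<theta> then THE \<theta>. is_jitter_point N \<theta> else theta_b N)"

definition jitter_rho :: "jackson_network \<Rightarrow> real" where
  "jitter_rho N = (let (\<theta>1, \<theta>2) = theta_j N in
     (arr2 N * exp \<theta>2 + serv1 N * route12 N * exp (- \<theta>1 + \<theta>2)) /
     (serv2 N * exit2 N * exp (- \<theta>2) + serv2 N * route21 N * exp (\<theta>1 - \<theta>2)))"

end

theory Submission
  imports Defs
begin

text \<open>
  Duality: a point \<open>\<theta>\<close> with \<open>M_plus N \<theta> \<le> 0\<close> and \<open>M_minus N \<theta> \<le> 0\<close> bounds every action from below by
  its first coordinate, and the bound is attained when some mixture of the two gradients at \<open>\<theta>\<close>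
  points in the direction of the positive first axis. At \<open>theta_b N\<close> the gradient of \<open>M_plus N\<close> alone
  does so; at a jitter point the second components of the two gradients have opposite signs, so a
  proper mixture does, and \<open>\<beta>\<close> is forced by stationarity. Stability yields a point \<open>p0\<close>, close to
  the origin and to its right, where both functions are negative; convexity along the segments from
  the origin to \<open>p0\<close> and from \<open>p0\<close> to any other admissible point then shows that a jitter point is
  unique and exists exactly when \<open>M_minus N (theta_b N) > 0\<close>.
\<close>

section \<open>Legendre transforms and convexity\<close>

lemma legendre_ge: "ereal (\<theta> \<bullet> v - M \<theta>) \<le> legendre M v"
  unfolding legendre_def by (rule SUP_upper) simp

text \<open>The tangent inequality says that \<open>\<theta>\<close> maximises the expression in the
  supremum: the equality case of Fenchel-Young.\<close>

lemma legendre_subgradient: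
  assumes "\<And>\<theta>'. M \<theta> + g \<bullet> (\<theta>' - \<theta>) \<le> M \<theta>'"
  shows "legendre M g = ereal (\<theta> \<bullet> g - M \<theta>)"
proof (rule antisym)
  show "legendre M g \<le> ereal (\<theta> \<bullet> g - M \<theta>)"
    unfolding legendre_def
  proof (rule SUP_least)
    fix \<theta>'
    show "ereal (\<theta>' \<bullet> g - M \<theta>') \<le> ereal (\<theta> \<bullet> g - M \<theta>)"
      using assms[of \<theta>'] by (simp add: inner_diff_right inner_commute)
  qed
qed (rule legendre_ge)

text \<open>Averaging the supporting inequalities at the convex combination \<open>z\<close> cancels
  the linear terms.\<close>

lemma convex_on_subgradient:
  fixes M :: "'a::real_inner \<Rightarrow> real"
  assumes "\<And>\<theta> \<theta>'. M \<theta> + G \<theta> \<bullet> (\<theta>' - \<theta>) \<le> M \<theta>'"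
  shows "convex_on UNIV M"
proof (rule convex_onI)
  fix t :: real and x y :: 'a
  assume t: "0 < t" "t < 1"
  define z where "z = (1 - t) *\<^sub>R x + t *\<^sub>R y"
  have "(1 - t) * (M z + G z \<bullet> (x - z)) \<le> (1 - t) * M x" "t * (M z + G z \<bullet> (y - z)) \<le> t * M y"
    using assms t by (simp_all add: mult_left_mono)
  moreover have "(1 - t) * (M z + G z \<bullet> (x - z)) + t * (M z + G z \<bullet> (y - z))
      = M z + G z \<bullet> ((1 - t) *\<^sub>R x + t *\<^sub>R y - z)"
    by (simp add: algebra_simps inner_diff_right inner_add_right)
  ultimately show "M ((1 - t) *\<^sub>R x + t *\<^sub>R y) \<le> (1 - t) * M x + t * M y"
    by (simp add: z_def)
qed simp

text \<open>The point lies on the segment from the origin to \<open>p\<close> or, past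
  \<open>p\<close>, on the segment from \<open>p\<close> to \<open>u\<close>. It is chosen before
  \<open>f\<close>, so one point serves \<open>M_plus N\<close> and \<open>M_minus N\<close>
  simultaneously.\<close>

lemma convex_slice_point:
  fixes p u :: "real \<times> real"
  assumes "0 < t" "t \<le> fst p \<or> t < fst u"
  obtains e where "fst e = t"
    "\<And>f :: real \<times> real \<Rightarrow> real. convex_on UNIV f \<Longrightarrow> f 0 \<le> 0 \<Longrightarrow> f p < 0 \<Longrightarrow> f u \<le> 0 \<Longrightarrow> f e < 0"
proof (cases "t \<le> fst p")
  case True
  define k where "k = t / fst p"
  have k: "0 < k" "k \<le> 1" "k * fst p = t" using True assms by (auto simp: k_def)
  show ?thesis
  proof
    show "fst (k *\<^sub>R p) = t" using k by simp
    fix f :: "real \<times> real \<Rightarrow> real"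
    assume f: "convex_on UNIV f" "f 0 \<le> 0" "f p < 0" "f u \<le> 0"
    have "f ((1 - k) *\<^sub>R 0 + k *\<^sub>R p) \<le> (1 - k) * f 0 + k * f p"
      using f k by (intro convex_onD) auto
    moreover have "(1 - k) * f 0 \<le> 0" "k * f p < 0"
      using f k by (auto simp: mult_le_0_iff mult_less_0_iff)
    ultimately show "f (k *\<^sub>R p) < 0" by simp
  qed
next
  case False
  define k where "k = (t - fst p) / (fst u - fst p)"
  have k: "0 < k" "k < 1" "k * (fst u - fst p) = t - fst p"
    using False assms by (auto simp: k_def)
  show ?thesis
  proof
    show "fst ((1 - k) *\<^sub>R p + k *\<^sub>R u) = t" using k by (simp add: algebra_simps)
    fix f :: "real \<times> real \<Rightarrow> real"
    assume f: "convex_on UNIV f" "f 0 \<le> 0" "f p < 0" "f u \<le> 0"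
    have "f ((1 - k) *\<^sub>R p + k *\<^sub>R u) \<le> (1 - k) * f p + k * f u"
      using f k by (intro convex_onD) auto
    moreover have "(1 - k) * f p < 0" "k * f u \<le> 0"
      using f k by (auto simp: mult_le_0_iff mult_less_0_iff)
    ultimately show "f ((1 - k) *\<^sub>R p + k *\<^sub>R u) < 0" by simp
  qed
qed

text \<open>Weak duality: Fenchel-Young is applied to both transforms at the same
  \<open>\<theta>\<close>, and the mixture constraint merges the two velocity terms.\<close>

lemma mix_cost_ge:
  assumes "mixture w \<beta> vp vm"
  shows "ereal (\<theta> \<bullet> w - (\<beta> * M_plus N \<theta> + (1 - \<beta>) * M_minus N \<theta>)) \<le> mix_cost N \<beta> vp vm"
proof -
  have b: "0 \<le> \<beta>" "\<beta> \<le> 1" and w: "w = \<beta> *\<^sub>R vp + (1 - \<beta>) *\<^sub>R vm"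
    using assms by (auto simp: mixture_def)
  have "ereal \<beta> * ereal (\<theta> \<bullet> vp - M_plus N \<theta>) + ereal (1 - \<beta>) * ereal (\<theta> \<bullet> vm - M_minus N \<theta>)
     \<le> mix_cost N \<beta> vp vm"
    unfolding mix_cost_def Lambda_plus_def Lambda_minus_def
    using b by (intro add_mono ereal_mult_left_mono legendre_ge) auto
  then show ?thesis
    by (simp add: w inner_add_right algebra_simps)
qed

section \<open>Gradients and elementary inequalities\<close>

definition grad_plus :: "jackson_network \<Rightarrow> real \<times> real \<Rightarrow> real \<times> real" where
  "grad_plus N = (\<lambda>(t, s).
     (arr1 N * exp t - serv1 N * exit1 N * exp (- t) - serv1 N * route12 N * exp (s - t)
        + serv2 N * route21 N * exp (t - s),
      arr2 N * exp s + serv1 N * route12 N * exp (s - t) - serv2 N * exit2 N * exp (- s)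
        - serv2 N * route21 N * exp (t - s)))"

definition grad_minus :: "jackson_network \<Rightarrow> real \<times> real \<Rightarrow> real \<times> real" where
  "grad_minus N = (\<lambda>(t, s).
     (arr1 N * exp t - serv1_star N * exit1 N * exp (- t)
        - serv1_star N * route12 N * exp (s - t),
      arr2 N * exp s + serv1_star N * route12 N * exp (s - t)))"

lemma DERIV_plus_2: "((\<lambda>s. M_plus N (t, s)) has_real_derivative snd (grad_plus N (t, s))) (at s)"
  unfolding M_plus_def grad_plus_def
  by (auto intro!: derivative_eq_intros simp: algebra_simps)

lemma partial2_plus: "partial2 (M_plus N) \<theta> = snd (grad_plus N \<theta>)"
  unfolding partial2_def using DERIV_imp_deriv[OF DERIV_plus_2, of N "fst \<theta>" "snd \<theta>"] by simp

lemma DERIV_minus_2: "((\<lambda>s. M_minus N (t, s)) has_real_derivative snd (grad_minus N (t, s))) (at s)"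
  unfolding M_minus_def grad_minus_def
  by (auto intro!: derivative_eq_intros simp: algebra_simps)

lemma DERIV_plus_ray:
  "((\<lambda>h. M_plus N (h, h * d)) has_real_derivative
     (arr1 N - serv1 N + serv2 N * route21 N) + d * (arr2 N + serv1 N * route12 N - serv2 N)) (at 0)"
  unfolding M_plus_def exit1_def exit2_def
  by (auto intro!: derivative_eq_intros simp: algebra_simps)

lemma DERIV_minus_ray:
  "((\<lambda>h. M_minus N (h, h * d)) has_real_derivative
     (arr1 N - serv1_star N) + d * (arr2 N + serv1_star N * route12 N)) (at 0)"
  unfolding M_minus_def exit1_def
  by (auto intro!: derivative_eq_intros simp: algebra_simps)

text \<open>\<open>M_plus N\<close> and \<open>M_minus N\<close> are sums of such terms with
  exponents linear in \<open>\<theta>\<close>, so their tangent inequalities follow by adding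
  instances.\<close>

lemma exp_tangent:
  fixes c u w :: real
  assumes "0 \<le> c"
  shows "c * (exp u - 1) + c * exp u * (w - u) \<le> c * (exp w - 1)"
proof -
  have "exp u * (1 + (w - u)) \<le> exp u * exp (w - u)"
    by (intro mult_left_mono exp_ge_add_one_self) auto
  then have "exp u * (1 + (w - u)) \<le> exp w" by (simp flip: exp_add)
  from mult_left_mono[OF this assms] show ?thesis by (simp add: algebra_simps)
qed

text \<open>Here \<open>d\<close> is the slope of a ray from the origin. The second inequality
  bounds \<open>d\<close> from above; so does the first if \<open>Q > 0\<close>, while for
  \<open>Q < 0\<close> it bounds \<open>d\<close> from below and the determinant condition makes the
  two compatible.\<close>

lemma exists_descent_direction:
  fixes P Q R S :: real
  assumes "0 < S" and neg: "Q \<le> 0 \<Longrightarrow> P * S - Q * R < 0"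
  shows "\<exists>d. P + d * Q < 0 \<and> R + d * S < 0"
proof (cases "0 < Q")
  case True
  define d where "d = min (- P / Q) (- R / S) - 1"
  have "d < - P / Q" "d < - R / S" by (auto simp: d_def)
  then show ?thesis using True assms by (intro exI[of _ d]) (simp add: field_simps)
next
  case False
  show ?thesis
  proof (cases "Q = 0")
    case True
    then have "P < 0" using neg assms by (simp add: mult_less_0_iff)
    then show ?thesis using True assms by (intro exI[of _ "- R / S - 1"]) (simp add: field_simps)
  next
    case nz: False
    then have Q: "Q < 0" using False by simp
    then have "- P / Q < - R / S" using neg assms by (simp add: field_simps)
    then obtain d where "- P / Q < d" "d < - R / S" using dense by blast
    then show ?thesis using Q assms by (intro exI[of _ d]) (simp add: field_simps)
  qed
qed

lemma le_times_of_divide_le: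
  fixes x :: ereal
  assumes "x / ereal v \<le> ereal c" "0 < v"
  shows "x \<le> ereal (c * v)"
  using assms by (cases x) (auto simp: field_simps)

section \<open>Tangent inequalities, monotonicity and a common negative point\<close>

locale stable_network =
  fixes N :: jackson_network and l1 l2 rho2 :: real
  assumes arr: "0 \<le> arr1 N" "0 \<le> arr2 N"
    and serv: "0 < serv1 N" "0 < serv2 N" "serv1 N \<le> serv1_star N"
    and route: "0 \<le> route12 N" "route12 N \<le> 1" "0 \<le> route21 N" "route21 N \<le> 1"
      "route12 N * route21 N < 1"
    and traffic: "l1 = arr1 N + l2 * route21 N" "l2 = arr2 N + l1 * route12 N"
    and rates: "0 < l1" "0 < l2"
    and rho2: "rho2 = l2 / serv2 N"
    and stable: "rho2 < 1" "l1 < rho2 * serv1 N + (1 - rho2) * serv1_star N"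
begin

lemma exit: "0 \<le> exit1 N" "0 \<le> exit2 N"
  using route by (auto simp: exit1_def exit2_def)

lemma M_plus_tangent: "M_plus N \<theta> + grad_plus N \<theta> \<bullet> (\<theta>' - \<theta>) \<le> M_plus N \<theta>'"
proof (cases \<theta>; cases \<theta>')
  fix t s t' s' assume [simp]: "\<theta> = (t, s)" "\<theta>' = (t', s')"
  have c: "0 \<le> serv1 N * exit1 N" "0 \<le> serv1 N * route12 N" "0 \<le> serv2 N * exit2 N"
      "0 \<le> serv2 N * route21 N"
    using serv route exit by simp_all
  show ?thesis
    using exp_tangent[OF arr(1), of t t'] exp_tangent[OF arr(2), of s s']
      exp_tangent[OF c(1), of "-t" "-t'"] exp_tangent[OF c(2), of "s-t" "s'-t'"]
      exp_tangent[OF c(3), of "-s" "-s'"] exp_tangent[OF c(4), of "t-s" "t'-s'"]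
    by (simp add: M_plus_def grad_plus_def algebra_simps)
qed

lemma M_minus_tangent: "M_minus N \<theta> + grad_minus N \<theta> \<bullet> (\<theta>' - \<theta>) \<le> M_minus N \<theta>'"
proof (cases \<theta>; cases \<theta>')
  fix t s t' s' assume [simp]: "\<theta> = (t, s)" "\<theta>' = (t', s')"
  have c: "0 \<le> serv1_star N * exit1 N" "0 \<le> serv1_star N * route12 N"
    using serv route exit by simp_all
  show ?thesis
    using exp_tangent[OF arr(1), of t t'] exp_tangent[OF arr(2), of s s']
      exp_tangent[OF c(1), of "-t" "-t'"] exp_tangent[OF c(2), of "s-t" "s'-t'"]
    by (simp add: M_minus_def grad_minus_def algebra_simps)
qed

lemmas convex_plus = convex_on_subgradient[of "M_plus N" "grad_plus N", OF M_plus_tangent]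
lemmas convex_minus = convex_on_subgradient[of "M_minus N" "grad_minus N", OF M_minus_tangent]

lemma M_zero [simp]: "M_plus N 0 = 0" "M_minus N 0 = 0"
  by (simp_all add: M_plus_def M_minus_def zero_prod_def)

lemma M_plus_tangent_2:
  "M_plus N (t, s) + snd (grad_plus N (t, s)) * (s' - s) \<le> M_plus N (t, s')"
  using M_plus_tangent[of "(t, s)" "(t, s')"] by (simp add: inner_prod_def)

text \<open>Otherwise queue 2 would receive no traffic, against \<open>0 < l2\<close>. This makes
  \<open>M_minus N\<close> strictly increasing in its second coordinate.\<close>

lemma arr2_or_route12: "0 < arr2 N \<or> 0 < route12 N"
  using arr route rates traffic by (metis add.right_neutral less_eq_real_def less_numeral_extra(3) mult_zero_right)

lemma arr2_route12_pos: "0 < c \<Longrightarrow> 0 < arr2 N + c * route12 N"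
  using arr2_or_route12 arr route by (auto intro: add_pos_nonneg add_nonneg_pos)

lemma grad_minus_2_pos: "0 < snd (grad_minus N (t, s))"
proof -
  have "snd (grad_minus N (t, s)) = exp s * (arr2 N + (serv1_star N * exp (- t)) * route12 N)"
    by (simp add: grad_minus_def exp_diff exp_minus field_simps)
  moreover have "0 < arr2 N + (serv1_star N * exp (- t)) * route12 N"
    using serv by (intro arr2_route12_pos) simp
  ultimately show ?thesis by simp
qed

lemma M_minus_strict_mono: "s < s' \<Longrightarrow> M_minus N (t, s) < M_minus N (t, s')"
  using DERIV_pos_imp_increasing[of s s' "\<lambda>s. M_minus N (t, s)"] DERIV_minus_2 grad_minus_2_pos
  by blast

lemma M_minus_less_iff: "M_minus N (t, s) < M_minus N (t, s') \<longleftrightarrow> s < s'"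
  using M_minus_strict_mono by (metis linorder_neqE_linordered_idom order_less_asym)

text \<open>Stability enters here. \<open>(P, Q)\<close> and \<open>(R, S)\<close> are the gradients
  at the origin, where both functions vanish; a small step in a common descent direction pointing
  right gives the point.\<close>

lemma interior_point: "\<exists>p. 0 < fst p \<and> M_plus N p < 0 \<and> M_minus N p < 0"
proof -
  define P Q R S where "P = arr1 N - serv1 N + serv2 N * route21 N"
    and "Q = arr2 N + serv1 N * route12 N - serv2 N"
    and "R = arr1 N - serv1_star N" and "S = arr2 N + serv1_star N * route12 N"
  have S: "0 < S" unfolding S_def using serv by (intro arr2_route12_pos) simp
  \<comment> \<open>With the weight \<open>\<beta>\<close> cancelling the second components, this
    determinant is \<open>\<beta> * P + (1 - \<beta>) * R\<close> times \<open>S - Q > 0\<close>, so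
    only the sign of that mixture matters.\<close>
  have "P * S - Q * R < 0" if Q: "Q \<le> 0"
  proof -
    text \<open>\<open>\<beta>\<close> is chosen to balance queue 2; \<open>m\<close> is the resulting mean service rate at node 1.\<close>
    define \<beta> where "\<beta> = S / (S - Q)"
    define m where "m = \<beta> * serv1 N + (1 - \<beta>) * serv1_star N"
    have bS: "\<beta> * (S - Q) = S" using S Q by (simp add: \<beta>_def)
    have bal: "arr2 N + m * route12 N = \<beta> * serv2 N"
      using bS unfolding m_def S_def Q_def by (simp add: algebra_simps)
    \<comment> \<open>If \<open>m \<le> l1\<close>, the balance equation gives
      \<open>\<beta> \<le> rho2\<close>; as the starred rate is the larger one, \<open>m\<close> is
      then at least the mean rate in the stability condition, which exceeds
      \<open>l1\<close>.\<close>
    have l1m: "l1 < m"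
    proof (rule ccontr)
      assume "\<not> l1 < m"
      then have "\<beta> * serv2 N \<le> rho2 * serv2 N"
        using mult_right_mono[of m l1 "route12 N"] bal traffic(2) rho2 serv route by simp
      then have "\<beta> \<le> rho2" using serv by simp
      then have "rho2 * (serv1_star N - serv1 N) \<ge> \<beta> * (serv1_star N - serv1 N)"
        using serv by (intro mult_right_mono) auto
      then have "rho2 * serv1 N + (1 - rho2) * serv1_star N \<le> m"
        unfolding m_def by (simp add: algebra_simps)
      then show False using stable \<open>\<not> l1 < m\<close> by simp
    qed
    \<comment> \<open>The balance equation eliminates \<open>\<beta>\<close> and the traffic
      equations eliminate the arrival rates, leaving a positive multiple of
      \<open>l1 - m\<close>.\<close>
    have "\<beta> * P + (1 - \<beta>) * R = arr1 N + (\<beta> * serv2 N) * route21 N - m"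
      unfolding P_def R_def m_def by (simp add: algebra_simps)
    also have "\<dots> = arr1 N + arr2 N * route21 N - m * (1 - route12 N * route21 N)"
      unfolding bal[symmetric] by (simp add: algebra_simps)
    also have "arr1 N + arr2 N * route21 N = l1 * (1 - route12 N * route21 N)"
    proof -
      have "l1 = arr1 N + (arr2 N + l1 * route12 N) * route21 N" using traffic by simp
      then show ?thesis by (simp add: algebra_simps)
    qed
    finally have "\<beta> * P + (1 - \<beta>) * R = (l1 - m) * (1 - route12 N * route21 N)"
      by (simp add: algebra_simps)
    also have "\<dots> < 0" using l1m route by (simp add: mult_less_0_iff)
    finally have "(\<beta> * P + (1 - \<beta>) * R) * (S - Q) < 0"
      using S Q by (simp add: mult_less_0_iff)
    moreover have "(\<beta> * P + (1 - \<beta>) * R) * (S - Q)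
        = (\<beta> * (S - Q)) * P + (S - Q - \<beta> * (S - Q)) * R"
      by (simp add: algebra_simps)
    ultimately show ?thesis unfolding bS by (simp add: algebra_simps)
  qed
  then obtain d where d: "P + d * Q < 0" "R + d * S < 0"
    using exists_descent_direction[of S Q P R] S by blast
  obtain e1 where e1: "0 < e1" "\<And>h. 0 < h \<Longrightarrow> h < e1 \<Longrightarrow> M_plus N (h, h * d) < 0"
    using DERIV_neg_dec_right[OF DERIV_plus_ray[of N d]] d M_zero
    unfolding P_def Q_def by (auto simp: zero_prod_def)
  obtain e2 where e2: "0 < e2" "\<And>h. 0 < h \<Longrightarrow> h < e2 \<Longrightarrow> M_minus N (h, h * d) < 0"
    using DERIV_neg_dec_right[OF DERIV_minus_ray[of N d]] d M_zero
    unfolding R_def S_def by (auto simp: zero_prod_def)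
  define h where "h = min e1 e2 / 2"
  have "0 < h" "h < e1" "h < e2" using e1 e2 by (auto simp: h_def)
  then show ?thesis using e1 e2 by (intro exI[of _ "(h, h * d)"]) auto
qed

definition p0 :: "real \<times> real" where
  "p0 = (SOME p. 0 < fst p \<and> M_plus N p < 0 \<and> M_minus N p < 0)"

lemma p0: "0 < fst p0" "M_plus N p0 < 0" "M_minus N p0 < 0"
  using someI_ex[OF interior_point] unfolding p0_def by auto

subsection \<open>The easternmost point\<close>

text \<open>On the vertical line at \<open>t\<close>, \<open>M_plus N\<close> is a combination of
  \<open>exp s\<close>, \<open>exp (- s)\<close> and a constant; this and the next two definitions
  are its coefficients (\<open>M_plus_slice\<close>).\<close>

definition up_coeff :: "real \<Rightarrow> real" where
  "up_coeff t = arr2 N + serv1 N * route12 N * exp (- t)"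

definition down_coeff :: "real \<Rightarrow> real" where
  "down_coeff t = serv2 N * exit2 N + serv2 N * route21 N * exp t"

definition rest_coeff :: "real \<Rightarrow> real" where
  "rest_coeff t = arr2 N + serv1 N + serv2 N - arr1 N * (exp t - 1) - serv1 N * exit1 N * exp (- t)"

lemma up_coeff_pos: "0 < up_coeff t"
  using arr2_route12_pos[of "serv1 N * exp (- t)"] serv unfolding up_coeff_def by (simp add: mult_ac)

lemma down_coeff_pos: "0 < down_coeff t"
proof -
  have "0 < exit2 N \<or> 0 < route21 N" by (auto simp: exit2_def)
  then show ?thesis
    unfolding down_coeff_def using serv exit route by (auto intro: add_pos_nonneg add_nonneg_pos)
qed

lemma M_plus_slice: "M_plus N (t, s) = up_coeff t * exp s + down_coeff t * exp (- s) - rest_coeff t"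
  by (simp add: M_plus_def up_coeff_def down_coeff_def rest_coeff_def exit1_def exit2_def exp_diff exp_minus
      field_simps)

lemma grad_plus_2: "snd (grad_plus N (t, s)) = up_coeff t * exp s - down_coeff t * exp (- s)"
  by (simp add: grad_plus_def up_coeff_def down_coeff_def exp_diff exp_minus field_simps)

lemma continuous_coeffs [continuous_intros]:
  "continuous_on X up_coeff" "continuous_on X down_coeff" "continuous_on X rest_coeff"
  unfolding up_coeff_def down_coeff_def rest_coeff_def by (intro continuous_intros)+

text \<open>The minimiser of \<open>M_plus N\<close> on the vertical line at \<open>t\<close>, where
  the two exponential terms are equal.\<close>

definition valley :: "real \<Rightarrow> real" where
  "valley t = (ln (down_coeff t) - ln (up_coeff t)) / 2"

lemma grad_plus_2_zero_iff: "snd (grad_plus N (t, s)) = 0 \<longleftrightarrow> s = valley t"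
proof -
  have "snd (grad_plus N (t, s)) = 0 \<longleftrightarrow> ln (up_coeff t * exp s) = ln (down_coeff t * exp (- s))"
    using up_coeff_pos down_coeff_pos by (simp add: grad_plus_2)
  also have "\<dots> \<longleftrightarrow> ln (up_coeff t) + s = ln (down_coeff t) - s"
    using up_coeff_pos[of t] down_coeff_pos[of t] by (simp add: ln_mult)
  finally show ?thesis by (auto simp: valley_def)
qed

lemma M_plus_valley_le: "M_plus N (t, valley t) \<le> M_plus N (t, s)"
  using M_plus_tangent_2[of t "valley t" s] grad_plus_2_zero_iff[of t "valley t"] by simp

text \<open>Bounding \<open>exp u\<close> below by \<open>1 + u\<close> with the common coefficient
  \<open>c\<close> for \<open>exp s\<close> and \<open>exp (t - s)\<close> cancels \<open>s\<close>
  and leaves linear growth in \<open>t\<close> with slope \<open>arr1 N + c\<close>.\<close>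

lemma M_plus_eventually_pos: "\<exists>T. \<forall>t\<ge>T. \<forall>s. 0 < M_plus N (t, s)"
proof -
  define c where "c = min (arr2 N) (serv2 N * route21 N)"
  define C where "C = arr1 N + arr2 N + serv1 N + serv2 N"
  have c: "0 \<le> c" "c \<le> arr2 N" "c \<le> serv2 N * route21 N"
    using arr serv route by (auto simp: c_def)
  \<comment> \<open>If \<open>arr1 N = 0\<close>, node 1 is fed only through node 2, so
    \<open>route21 N > 0\<close>; and \<open>arr2 N > 0\<close>, since otherwise \<open>l1\<close>
    would equal \<open>l1\<close> times a routing product below 1.\<close>
  have ac: "0 < arr1 N + c"
  proof (cases "arr1 N = 0")
    case True
    have "arr2 N \<noteq> 0"
    proof
      assume "arr2 N = 0"
      then have "l1 = l1 * (route12 N * route21 N)" using traffic True by (simp add: mult_ac)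
      then show False using rates route by simp
    qed
    moreover have "route21 N \<noteq> 0" using True traffic rates by auto
    ultimately show ?thesis using True arr serv route by (simp add: c_def)
  qed (use arr c in auto)
  have "0 < M_plus N (t, s)" if t: "t \<ge> (C + 1) / (arr1 N + c)" for t s
  proof -
    have low: "k * (1 + u) \<le> l * exp u" if "0 \<le> k" "k \<le> l" for k l u :: real
      using mult_left_mono[OF exp_ge_add_one_self that(1), of u] mult_right_mono[OF that(2) exp_ge_zero, of u]
      by linarith
    have "arr1 N + arr1 N * t \<le> arr1 N * exp t" "c + c * s \<le> arr2 N * exp s"
      "c + c * t - c * s \<le> serv2 N * route21 N * exp (t - s)"
      using low[of "arr1 N" "arr1 N" t] low[of c "arr2 N" s] low[of c "serv2 N * route21 N" "t - s"]
        arr c by (simp_all add: algebra_simps)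
    moreover have "0 \<le> serv1 N * exit1 N * exp (- t)" "0 \<le> serv1 N * route12 N * exp (s - t)"
      "0 \<le> serv2 N * exit2 N * exp (- s)"
      using serv exit route by auto
    moreover have "C + 1 \<le> arr1 N * t + c * t" using t ac by (simp add: field_simps)
    moreover have "M_plus N (t, s) = arr1 N * exp t + arr2 N * exp s + serv1 N * exit1 N * exp (- t)
      + serv1 N * route12 N * exp (s - t) + serv2 N * exit2 N * exp (- s)
      + serv2 N * route21 N * exp (t - s) - C"
      by (simp add: M_plus_def exit1_def exit2_def C_def algebra_simps)
    ultimately show ?thesis using arr c by linarith
  qed
  then show ?thesis by blast
qed

text \<open>Intermediate value theorem along the valley, which is negative on the line through
  \<open>p0\<close> and positive far to the right.\<close>

lemma easternmost_exists:
  "\<exists>t > fst p0. M_plus N (t, valley t) = 0"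
proof -
  obtain T where T: "\<And>t s. t \<ge> T \<Longrightarrow> 0 < M_plus N (t, s)" using M_plus_eventually_pos by blast
  define U where "U = max T (fst p0)"
  have neg: "M_plus N (fst p0, valley (fst p0)) < 0"
    using M_plus_valley_le[of "fst p0" "snd p0"] p0 by simp
  moreover have "0 < M_plus N (U, valley U)" using T by (simp add: U_def)
  moreover have "continuous_on {fst p0..U} (\<lambda>t. M_plus N (t, valley t))"
    unfolding M_plus_slice valley_def
    by (intro continuous_intros) (use up_coeff_pos down_coeff_pos in \<open>auto simp: less_imp_neq[symmetric]\<close>)
  moreover have "fst p0 \<le> U" by (simp add: U_def)
  ultimately obtain t where "fst p0 \<le> t" "M_plus N (t, valley t) = 0"
    using IVT'[of "\<lambda>t. M_plus N (t, valley t)" "fst p0" 0 U] by auto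
  then show ?thesis using neg by (metis order_le_less less_irrefl)
qed

text \<open>Were \<open>u\<close> further right, convexity would give a negative value on the line
  at \<open>T\<close>, below the valley minimum 0.\<close>

lemma easternmost_right:
  assumes "M_plus N (T, valley T) = 0" "0 < T" "M_plus N u \<le> 0"
  shows "fst u \<le> T"
proof (rule ccontr)
  assume "\<not> fst u \<le> T"
  then have "T \<le> fst p0 \<or> T < fst u" by simp
  then obtain e where e: "fst e = T" "M_plus N e < 0"
    using convex_slice_point[OF \<open>0 < T\<close>] assms convex_plus p0 by (metis M_zero(1) order_refl)
  then show False using M_plus_valley_le[of T "snd e"] assms by (cases e) auto
qed

lemma theta_b_unique:
  "\<exists>!\<theta>. 0 < fst \<theta> \<and> partial2 (M_plus N) \<theta> = 0 \<and> M_plus N \<theta> = 0"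
proof -
  obtain T where T: "fst p0 < T" "M_plus N (T, valley T) = 0" using easternmost_exists by blast
  show ?thesis
  proof (rule ex1I[of _ "(T, valley T)"])
    show "0 < fst (T, valley T) \<and> partial2 (M_plus N) (T, valley T) = 0 \<and> M_plus N (T, valley T) = 0"
      using T p0 by (simp add: partial2_plus grad_plus_2_zero_iff)
    fix \<theta> :: "real \<times> real"
    assume a: "0 < fst \<theta> \<and> partial2 (M_plus N) \<theta> = 0 \<and> M_plus N \<theta> = 0"
    obtain t s where [simp]: "\<theta> = (t, s)" by fastforce
    have s: "s = valley t" using a by (simp add: partial2_plus grad_plus_2_zero_iff)
    have "t \<le> T" using easternmost_right[of T \<theta>] T a p0 by simp
    moreover have "T \<le> t" using easternmost_right[of t "(T, valley T)"] T a p0 s by simp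
    ultimately show "\<theta> = (T, valley T)" using s by simp
  qed
qed

lemma theta_b:
  "0 < fst (theta_b N)" "snd (grad_plus N (theta_b N)) = 0" "M_plus N (theta_b N) = 0"
  using theI'[OF theta_b_unique] unfolding theta_b_def[symmetric] by (auto simp: partial2_plus)

lemma snd_theta_b: "snd (theta_b N) = valley (fst (theta_b N))"
  using theta_b(2) grad_plus_2_zero_iff[of "fst (theta_b N)" "snd (theta_b N)"] by simp

lemma M_plus_theta_b_valley: "M_plus N (fst (theta_b N), valley (fst (theta_b N))) = 0"
  using theta_b(3) by (simp flip: snd_theta_b)

lemma theta_b_east: "M_plus N u \<le> 0 \<Longrightarrow> fst u \<le> fst (theta_b N)"
  using easternmost_right[OF M_plus_theta_b_valley theta_b(1)] by blast

lemma p0_theta_b: "fst p0 < fst (theta_b N)"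
proof -
  obtain T where T: "fst p0 < T" "M_plus N (T, valley T) = 0" using easternmost_exists by blast
  then show ?thesis using theta_b_east[of "(T, valley T)"] by simp
qed

text \<open>The minimum of \<open>M_plus N\<close> on this line is 0, so such a point is a
  minimiser, hence stationary, hence the valley point.\<close>

lemma theta_b_slice:
  assumes "fst \<theta> = fst (theta_b N)" "M_plus N \<theta> \<le> 0"
  shows "\<theta> = theta_b N"
proof -
  obtain t s where ts: "\<theta> = (t, s)" by fastforce
  have "M_plus N (t, s) \<le> M_plus N (t, s')" for s'
    using M_plus_valley_le[of t s'] M_plus_theta_b_valley assms ts by simp
  then have "snd (grad_plus N (t, s)) = 0"
    using DERIV_local_min[OF DERIV_plus_2 zero_less_one] by blast
  then show ?thesis
    using assms(1) snd_theta_b ts by (simp add: grad_plus_2_zero_iff prod_eq_iff)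
qed

subsection \<open>The jitter point\<close>

lemma is_jitter_point_iff:
  "is_jitter_point N \<theta> \<longleftrightarrow>
     0 < fst \<theta> \<and> M_plus N \<theta> = 0 \<and> M_minus N \<theta> = 0 \<and> snd (grad_plus N \<theta>) < 0"
  by (cases \<theta>) (simp add: is_jitter_point_def partial2_plus)

text \<open>A negative \<open>M_minus N e\<close> would put \<open>e\<close> below
  \<open>\<theta>\<close>, where the downward sloping tangent at \<open>\<theta>\<close> keeps
  \<open>M_plus N\<close> positive.\<close>

lemma jitter_point_slice:
  assumes j: "is_jitter_point N \<theta>" and e: "fst e = fst \<theta>" "M_plus N e < 0"
  shows "0 \<le> M_minus N e"
proof (rule ccontr)
  assume m: "\<not> 0 \<le> M_minus N e"
  obtain t s s' where [simp]: "\<theta> = (t, s)" "e = (t, s')" using e by (cases \<theta>; cases e) auto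
  have "s' < s" using m j M_minus_less_iff[of t s' s] by (simp add: is_jitter_point_iff)
  moreover have "snd (grad_plus N (t, s)) * (s' - s) < 0"
    using M_plus_tangent_2[of t s s'] e j by (simp add: is_jitter_point_iff)
  ultimately show False using j by (auto simp: is_jitter_point_iff mult_less_0_iff)
qed

text \<open>Otherwise convexity would put a point where both functions are negative on the line
  through \<open>\<theta>\<close>.\<close>

lemma jitter_point_east:
  assumes j: "is_jitter_point N \<theta>" and u: "M_plus N u \<le> 0" "M_minus N u \<le> 0"
  shows "fst u \<le> fst \<theta>" "fst p0 < fst \<theta>"
proof -
  have pos: "0 < fst \<theta>" using j by (simp add: is_jitter_point_iff)
  have *: False if "fst \<theta> \<le> fst p0 \<or> fst \<theta> < fst w" "M_plus N w \<le> 0" "M_minus N w \<le> 0" for w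
  proof -
    obtain e where "fst e = fst \<theta>" "M_plus N e < 0" "M_minus N e < 0"
      by (rule convex_slice_point[OF pos \<open>fst \<theta> \<le> fst p0 \<or> fst \<theta> < fst w\<close>]) (use convex_plus convex_minus p0 \<open>M_plus N w \<le> 0\<close> \<open>M_minus N w \<le> 0\<close> in auto)
    then show False using jitter_point_slice[OF j, of e] by simp
  qed
  show "fst u \<le> fst \<theta>" using *[of u] u by force
  show "fst p0 < fst \<theta>" using *[of p0] p0 by force
qed

lemma jitter_point_unique:
  assumes "is_jitter_point N \<theta>" "is_jitter_point N \<theta>'"
  shows "\<theta> = \<theta>'"
proof -
  have "fst \<theta> = fst \<theta>'"
    using jitter_point_east(1)[OF assms(1), of \<theta>'] jitter_point_east(1)[OF assms(2), of \<theta>] assms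
    by (simp add: is_jitter_point_iff)
  moreover have "snd \<theta> = snd \<theta>'"
    using assms calculation M_minus_less_iff[of "fst \<theta>" "snd \<theta>" "snd \<theta>'"]
      M_minus_less_iff[of "fst \<theta>" "snd \<theta>'" "snd \<theta>"]
    by (metis is_jitter_point_iff less_irrefl linorder_neqE_linordered_idom prod.collapse)
  ultimately show ?thesis by (simp add: prod_eq_iff)
qed

text \<open>The inequality is strict because the slopes of \<open>M_plus N\<close> differ at the two
  points. If \<open>M_minus N\<close> were nonpositive at \<open>theta_b N\<close>, that admissible
  point would lie east of the jitter point.\<close>

lemma jitter_point_theta_b:
  assumes j: "is_jitter_point N \<theta>"
  shows "fst \<theta> < fst (theta_b N)" "0 < M_minus N (theta_b N)"
proof -
  have "fst \<theta> \<le> fst (theta_b N)" using theta_b_east[of \<theta>] j by (simp add: is_jitter_point_iff)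
  moreover have "fst \<theta> \<noteq> fst (theta_b N)"
    using theta_b_slice[of \<theta>] j theta_b(2) by (metis is_jitter_point_iff less_irrefl order_refl)
  ultimately show "fst \<theta> < fst (theta_b N)" by simp
  then show "0 < M_minus N (theta_b N)"
    using jitter_point_east(1)[OF j, of "theta_b N"] theta_b by force
qed

text \<open>The difference of \<open>M_plus N\<close> and \<open>M_minus N\<close> does not decrease
  under moves right or down. It is 0 at \<open>\<theta>\<close> and negative at
  \<open>theta_b N\<close>, so \<open>theta_b N\<close> must lie above.\<close>

lemma jitter_point_below_theta_b:
  assumes j: "is_jitter_point N \<theta>"
  shows "snd \<theta> < snd (theta_b N)"
proof (rule ccontr)
  assume "\<not> snd \<theta> < snd (theta_b N)"
  moreover obtain t s t' s' where [simp]: "\<theta> = (t, s)" "theta_b N = (t', s')"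
    by (cases \<theta>; cases "theta_b N") auto
  ultimately have le: "t \<le> t'" "s' \<le> s" using jitter_point_theta_b(1)[OF j] by auto
  have diff: "M_plus N (t, s) - M_minus N (t, s) =
      (serv1_star N - serv1 N) * (1 - exit1 N * exp (- t) - route12 N * exp (s - t))
      + serv2 N * (exit2 N * exp (- s) + route21 N * exp (t - s) - 1)" for t s
    by (simp add: M_plus_def M_minus_def exit1_def exit2_def algebra_simps)
  have "M_plus N (t, s) - M_minus N (t, s) \<le> M_plus N (t', s') - M_minus N (t', s')"
    unfolding diff using le serv route exit
    by (intro add_mono mult_left_mono diff_mono) auto
  then show False
    using j jitter_point_theta_b(2)[OF j] theta_b(3) by (simp add: is_jitter_point_iff)
qed

section \<open>The lower arc of the curve \<open>M_plus N = 0\<close>\<close>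

definition disc :: "real \<Rightarrow> real" where
  "disc t = (rest_coeff t)\<^sup>2 - 4 * up_coeff t * down_coeff t"

text \<open>With \<open>y = exp s\<close>, the equation \<open>M_plus N (t, s) = 0\<close> is
  quadratic in \<open>y\<close> with discriminant \<open>disc t\<close>; this is the logarithm of
  the smaller root.\<close>

definition lower :: "real \<Rightarrow> real" where
  "lower t = ln ((rest_coeff t - sqrt (disc t)) / (2 * up_coeff t))"

lemma lower:
  assumes "M_plus N (t, s) \<le> 0"
  shows "0 < (rest_coeff t - sqrt (disc t)) / (2 * up_coeff t)"
    and "M_plus N (t, lower t) = 0" and "snd (grad_plus N (t, lower t)) \<le> 0"
proof -
  define A B K where "A = up_coeff t" and "B = down_coeff t" and "K = rest_coeff t"
  define D where "D = sqrt (disc t)"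
  have A: "0 < A" and B: "0 < B" using up_coeff_pos down_coeff_pos by (simp_all add: A_def B_def)
  have le: "A * exp s + B * exp (- s) \<le> K"
    using assms by (simp add: M_plus_slice A_def B_def K_def)
  have pos: "0 < A * exp s + B * exp (- s)" using A B by (intro add_pos_pos) auto
  then have K: "0 < K" using le by simp
  have "4 * A * B = (A * exp s + B * exp (- s))\<^sup>2 - (A * exp s - B * exp (- s))\<^sup>2"
    by (simp add: power2_eq_square algebra_simps flip: exp_add)
  also have "\<dots> \<le> K\<^sup>2"
    using power_mono[OF le, of 2] pos zero_le_power2[of "A * exp s - B * exp (- s)"] by linarith
  finally have disc: "0 \<le> disc t" "disc t = K\<^sup>2 - 4 * A * B"
    by (simp_all add: disc_def A_def B_def K_def)
  have D: "0 \<le> D" "D\<^sup>2 = K\<^sup>2 - 4 * A * B" using disc by (simp_all add: D_def)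
  have "D < K"
  proof (rule power2_less_imp_less)
    show "D\<^sup>2 < K\<^sup>2" using D A B by simp
  qed (use K in simp)
  define y where "y = (K - D) / (2 * A)"
  have y: "0 < y" using \<open>D < K\<close> A by (simp add: y_def)
  then show "0 < (rest_coeff t - sqrt (disc t)) / (2 * up_coeff t)"
    by (simp add: y_def K_def D_def A_def)
  have ly: "exp (lower t) = y"
    using y by (simp add: lower_def y_def K_def D_def A_def)
  have Ay: "A * y = (K - D) / 2" using A by (simp add: y_def)
  \<comment> \<open>The product of the two roots gives the \<open>exp (- s)\<close> term; the slope
    at the smaller root is then \<open>- D\<close>.\<close>
  have "(A * y) * ((K + D) / 2) = A * B"
    unfolding Ay using D by (simp add: power2_eq_square field_simps)
  then have "B = y * ((K + D) / 2)" using A by simp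
  then have By: "B * exp (- lower t) = (K + D) / 2" using y by (simp add: exp_minus ly field_simps)
  show "M_plus N (t, lower t) = 0"
    using By Ay by (simp add: M_plus_slice ly field_simps flip: A_def B_def K_def)
  show "snd (grad_plus N (t, lower t)) \<le> 0"
    using By Ay D by (simp add: grad_plus_2 ly field_simps flip: A_def B_def K_def)
qed

text \<open>The point is found by following the lower arc of \<open>M_plus N = 0\<close> from below \<open>p0\<close>, where
  \<open>M_minus N\<close> is negative, to \<open>theta_b N\<close>.\<close>

lemma jitter_point_exists:
  assumes pos: "0 < M_minus N (theta_b N)"
  shows "\<exists>\<theta>. is_jitter_point N \<theta>"
proof -
  define T where "T = fst (theta_b N)"
  have T: "0 < T" "fst p0 < T" using theta_b p0_theta_b by (simp_all add: T_def)
  have inner: "\<exists>s. M_plus N (t, s) < 0" if "fst p0 \<le> t" "t < T" for t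
  proof -
    have "0 < t" "t \<le> fst p0 \<or> t < fst (theta_b N)" using that p0 by (auto simp: T_def)
    then obtain e where "fst e = t" "M_plus N e < 0"
      using convex_slice_point convex_plus p0 theta_b(3) by (metis M_zero(1) order_refl)
    then show ?thesis by (cases e) auto
  qed
  have nonempty: "\<exists>s. M_plus N (t, s) \<le> 0" if "fst p0 \<le> t" "t \<le> T" for t
    using inner[of t] that M_plus_theta_b_valley unfolding T_def
    by (metis order_le_less order_refl)
  have cont: "continuous_on {fst p0..T} lower"
    unfolding lower_def disc_def
  proof (intro continuous_intros ballI)
    fix t assume t: "t \<in> {fst p0..T}"
    show "2 * up_coeff t \<noteq> 0" using up_coeff_pos[of t] by simp
    show "(rest_coeff t - sqrt ((rest_coeff t)\<^sup>2 - 4 * up_coeff t * down_coeff t)) / (2 * up_coeff t) \<noteq> 0"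
      using nonempty[of t] t lower(1)[of t] by (auto simp: disc_def)
  qed
  have "continuous_on {fst p0..T} (\<lambda>t. M_minus N (t, lower t))"
    unfolding M_minus_def split_conv by (intro continuous_intros cont)
  \<comment> \<open>The lower arc passes below \<open>p0\<close>, and \<open>M_minus N\<close>
    increases upwards.\<close>
  moreover have "M_minus N (fst p0, lower (fst p0)) < 0"
  proof -
    have low: "M_plus N (fst p0, lower (fst p0)) = 0" "snd (grad_plus N (fst p0, lower (fst p0))) \<le> 0"
      using lower[of "fst p0" "snd p0"] p0 by simp_all
    have "snd (grad_plus N (fst p0, lower (fst p0))) * (snd p0 - lower (fst p0)) < 0"
      using M_plus_tangent_2[of "fst p0" "lower (fst p0)" "snd p0"] low p0 by simp
    then have "lower (fst p0) < snd p0" using low(2) by (simp add: mult_less_0_iff)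
    then show ?thesis using M_minus_strict_mono[of "lower (fst p0)" "snd p0" "fst p0"] p0 by simp
  qed
  moreover have low_T: "(T, lower T) = theta_b N"
    using theta_b_slice[of "(T, lower T)"] lower(2)[of T] nonempty[of T] T by (auto simp: T_def)
  ultimately obtain t where t: "fst p0 \<le> t" "t \<le> T" "M_minus N (t, lower t) = 0"
    using IVT'[of "\<lambda>t. M_minus N (t, lower t)" "fst p0" 0 T] pos T by auto
  have "t < T" using t pos low_T by (cases "t = T") auto
  then obtain s where s: "M_plus N (t, s) < 0" using inner t by blast
  have low: "M_plus N (t, lower t) = 0" "snd (grad_plus N (t, lower t)) \<le> 0"
    using lower[of t s] s by simp_all
  \<comment> \<open>A horizontal tangent at height 0 would keep \<open>M_plus N\<close> nonnegative
    on the whole line, against \<open>s\<close>.\<close>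
  moreover have "snd (grad_plus N (t, lower t)) \<noteq> 0"
    using M_plus_tangent_2[of t "lower t" s] s low by auto
  ultimately have "is_jitter_point N (t, lower t)"
    using t p0 by (simp add: is_jitter_point_iff)
  then show ?thesis by blast
qed

section \<open>The two cases of \<open>theta_j\<close>\<close>

lemma theta_j_jitter: "0 < M_minus N (theta_b N) \<Longrightarrow> is_jitter_point N (theta_j N)"
  using jitter_point_exists jitter_point_unique theI'[of "is_jitter_point N"]
  unfolding theta_j_def by (smt (verit))

lemma theta_j_bridge: "\<not> 0 < M_minus N (theta_b N) \<Longrightarrow> theta_j N = theta_b N"
  unfolding theta_j_def using jitter_point_theta_b by auto

text \<open>These facts cover both cases at once, so that the duality argument below needs no
  separate treatment of jitter and bridge.\<close>

lemma theta_j: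
  "M_plus N (theta_j N) = 0" "M_minus N (theta_j N) \<le> 0" "fst p0 < fst (theta_j N)"
  "snd (grad_plus N (theta_j N)) \<le> 0"
  "snd (grad_plus N (theta_j N)) < 0 \<longleftrightarrow> 0 < M_minus N (theta_b N)"
  "snd (grad_plus N (theta_j N)) < 0 \<Longrightarrow> M_minus N (theta_j N) = 0"
  using theta_j_jitter theta_j_bridge theta_b p0_theta_b jitter_point_east(2)[OF theta_j_jitter, of 0]
  by (cases "0 < M_minus N (theta_b N)"; auto simp: is_jitter_point_iff)+

lemma theta_j_less_theta_b_iff:
  "fst (theta_j N) < fst (theta_b N) \<and> snd (theta_j N) < snd (theta_b N)
     \<longleftrightarrow> 0 < M_minus N (theta_b N)"
  using theta_j_jitter theta_j_bridge jitter_point_theta_b jitter_point_below_theta_b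
  by (cases "0 < M_minus N (theta_b N)") auto

text \<open>Numerator minus denominator is the second component of \<open>grad_plus N\<close> at
  \<open>theta_j N\<close>, and the denominator is positive.\<close>

lemma jitter_rho_less_1_iff: "jitter_rho N < 1 \<longleftrightarrow> 0 < M_minus N (theta_b N)"
proof -
  obtain t s where ts: "theta_j N = (t, s)" by fastforce
  have "serv2 N * exit2 N * exp (- s) + serv2 N * route21 N * exp (t - s) = down_coeff t * exp (- s)"
    by (simp add: down_coeff_def exp_diff exp_minus field_simps)
  then have "0 < serv2 N * exit2 N * exp (- s) + serv2 N * route21 N * exp (t - s)"
    using down_coeff_pos by simp
  then have "jitter_rho N < 1 \<longleftrightarrow> snd (grad_plus N (t, s)) < 0"
    by (simp add: jitter_rho_def ts grad_plus_def add.commute[of "- t"] algebra_simps)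
  then show ?thesis using theta_j(5) ts by simp
qed

subsection \<open>The value of the control problem\<close>

text \<open>The weight for which the mixed gradient at \<open>theta_j N\<close> is horizontal; it is
  1 in the bridge case.\<close>

definition mix_opt :: real where
  "mix_opt = snd (grad_minus N (theta_j N)) /
     (snd (grad_minus N (theta_j N)) - snd (grad_plus N (theta_j N)))"

lemma mix_opt_iff:
  "\<beta> * snd (grad_plus N (theta_j N)) + (1 - \<beta>) * snd (grad_minus N (theta_j N)) = 0
     \<longleftrightarrow> \<beta> = mix_opt"
proof -
  have "snd (grad_plus N (theta_j N)) < snd (grad_minus N (theta_j N))"
    using theta_j(4) grad_minus_2_pos[of "fst (theta_j N)" "snd (theta_j N)"] by simp
  then show ?thesis by (auto simp: mix_opt_def field_simps)
qed

lemma mix_opt: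
  "0 \<le> mix_opt" "mix_opt \<le> 1" "mix_opt < 1 \<longleftrightarrow> 0 < M_minus N (theta_b N)"
  using theta_j(4,5) grad_minus_2_pos[of "fst (theta_j N)" "snd (theta_j N)"]
  by (auto simp: mix_opt_def field_simps)

text \<open>Complementary slackness: either \<open>M_minus N\<close> vanishes at
  \<open>theta_j N\<close> or its weight does.\<close>

lemma mix_opt_zero: "mix_opt * M_plus N (theta_j N) + (1 - mix_opt) * M_minus N (theta_j N) = 0"
  using theta_j mix_opt by (cases "mix_opt < 1") auto

lemma mix_cost_lower:
  assumes "mixture (v, 0) \<beta> vp vm"
  shows "ereal (fst (theta_j N) * v) \<le> mix_cost N \<beta> vp vm"
proof -
  have "(1 - \<beta>) * M_minus N (theta_j N) \<le> 0"
    using theta_j assms by (auto simp: mixture_def mult_le_0_iff)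
  then have "ereal (fst (theta_j N) * v)
      \<le> ereal (theta_j N \<bullet> (v, 0) - (\<beta> * M_plus N (theta_j N) + (1 - \<beta>) * M_minus N (theta_j N)))"
    using theta_j by (simp add: inner_prod_def)
  also have "\<dots> \<le> mix_cost N \<beta> vp vm" by (rule mix_cost_ge[OF assms])
  finally show ?thesis .
qed

text \<open>The velocities are the gradients at \<open>theta_j N\<close>, where Fenchel-Young is an
  equality.\<close>

lemma mix_cost_attained:
  obtains v vp vm where "0 < v" "mixture (v, 0) mix_opt vp vm"
    "mix_cost N mix_opt vp vm = ereal (fst (theta_j N) * v)"
proof
  let ?\<theta> = "theta_j N"
  define v where "v = mix_opt * fst (grad_plus N ?\<theta>) + (1 - mix_opt) * fst (grad_minus N ?\<theta>)"
  have w: "mix_opt *\<^sub>R grad_plus N ?\<theta> + (1 - mix_opt) *\<^sub>R grad_minus N ?\<theta> = (v, 0)"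
    using mix_opt_iff[of mix_opt] by (simp add: v_def prod_eq_iff)
  then show mix: "mixture (v, 0) mix_opt (grad_plus N ?\<theta>) (grad_minus N ?\<theta>)"
    using mix_opt by (simp add: mixture_def)
  have "Lambda_plus N (grad_plus N ?\<theta>) = ereal (?\<theta> \<bullet> grad_plus N ?\<theta> - M_plus N ?\<theta>)"
    "Lambda_minus N (grad_minus N ?\<theta>) = ereal (?\<theta> \<bullet> grad_minus N ?\<theta> - M_minus N ?\<theta>)"
    unfolding Lambda_plus_def Lambda_minus_def
    by (intro legendre_subgradient M_plus_tangent M_minus_tangent)+
  then have "mix_cost N mix_opt (grad_plus N ?\<theta>) (grad_minus N ?\<theta>)
      = ereal (?\<theta> \<bullet> (v, 0) - (mix_opt * M_plus N ?\<theta> + (1 - mix_opt) * M_minus N ?\<theta>))"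
    by (simp add: mix_cost_def inner_add_right algebra_simps flip: w)
  then show "mix_cost N mix_opt (grad_plus N ?\<theta>) (grad_minus N ?\<theta>) = ereal (fst ?\<theta> * v)"
    by (simp add: mix_opt_zero inner_prod_def)
  \<comment> \<open>The mixed function vanishes at \<open>theta_j N\<close> and is negative at
    \<open>p0\<close> to its left, so by the tangent inequality its horizontal slope
    \<open>v\<close> is positive.\<close>
  have "(v, 0) \<bullet> (p0 - ?\<theta>)
     = (mix_opt * M_plus N ?\<theta> + (1 - mix_opt) * M_minus N ?\<theta>) + (v, 0) \<bullet> (p0 - ?\<theta>)"
    by (simp add: mix_opt_zero)
  also have "\<dots> = mix_opt * (M_plus N ?\<theta> + grad_plus N ?\<theta> \<bullet> (p0 - ?\<theta>))
      + (1 - mix_opt) * (M_minus N ?\<theta> + grad_minus N ?\<theta> \<bullet> (p0 - ?\<theta>))"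
    by (simp add: inner_add_left algebra_simps flip: w)
  also have "\<dots> \<le> mix_opt * M_plus N p0 + (1 - mix_opt) * M_minus N p0"
    using mix_opt by (intro add_mono mult_left_mono M_plus_tangent M_minus_tangent) auto
  also have "\<dots> < 0"
    using convex_bound_lt[of "M_plus N p0" 0 "M_minus N p0" mix_opt "1 - mix_opt"] p0 mix_opt by simp
  finally show "0 < v" using theta_j(3) by (simp add: inner_prod_def mult_less_0_iff)
qed

text \<open>At an optimum, the mixture of \<open>M_plus N\<close> and \<open>M_minus N\<close> has a minimum at \<open>theta_j N\<close>
  along the vertical line, so stationarity determines \<open>\<beta>\<close>.\<close>

lemma mix_cost_unique:
  assumes mix: "mixture (v, 0) \<beta> vp vm"
    and cost: "mix_cost N \<beta> vp vm \<le> ereal (fst (theta_j N) * v)"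
  shows "\<beta> = mix_opt"
proof -
  obtain t s where ts: "theta_j N = (t, s)" by fastforce
  define H where "H s = \<beta> * M_plus N (t, s) + (1 - \<beta>) * M_minus N (t, s)" for s
  \<comment> \<open>Compare the duality bound at the test point \<open>(t, s')\<close> with the
    assumed cost bound \<open>t * v\<close>.\<close>
  have "0 \<le> H s'" for s'
    using order_trans[OF mix_cost_ge[OF mix, of "(t, s')"] cost] by (simp add: H_def ts inner_prod_def)
  moreover have "H s \<le> 0"
    using theta_j(1,2) mix by (auto simp: H_def ts mixture_def mult_le_0_iff)
  ultimately have "\<forall>s'. \<bar>s - s'\<bar> < 1 \<longrightarrow> H s \<le> H s'" by (meson order_trans)
  moreover have "(H has_real_derivative
      \<beta> * snd (grad_plus N (t, s)) + (1 - \<beta>) * snd (grad_minus N (t, s))) (at s)"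
    unfolding H_def by (intro DERIV_add DERIV_cmult DERIV_plus_2 DERIV_minus_2)
  ultimately have "\<beta> * snd (grad_plus N (t, s)) + (1 - \<beta>) * snd (grad_minus N (t, s)) = 0"
    using DERIV_local_min zero_less_one by blast
  then show ?thesis using mix_opt_iff ts by simp
qed

section \<open>Optimal paths and the optimal mixing parameter\<close>

lemma Lambda_star_ge: "ereal (fst (theta_j N) * v) \<le> Lambda_star N (v, 0)"
  unfolding Lambda_star_def by (rule Inf_greatest) (auto intro: mix_cost_lower)

lemma path_action_ge:
  assumes "p \<in> F_x"
  shows "ereal (fst (theta_j N)) \<le> path_action N p"
proof -
  obtain v where v: "0 < v" "p = x_path v" using assms by (auto simp: F_x_def)
  have "ereal (fst (theta_j N) * v) / ereal v \<le> Lambda_star N (v, 0) / ereal v"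
    using v by (intro ereal_divide_right_mono Lambda_star_ge) simp
  then show ?thesis using v by (simp add: path_action_def x_speed_x_path)
qed

text \<open>The attaining mixture meets the lower bound on \<open>Lambda_star\<close>, so it also
  realises the inner infimum at its own speed.\<close>

lemma optimal_path_exists:
  "\<exists>p\<in>F_x. path_action N p = ereal (fst (theta_j N)) \<and> path_mixing N p mix_opt"
proof -
  obtain v vp vm where v: "0 < v" and mix: "mixture (v, 0) mix_opt vp vm"
    and cost: "mix_cost N mix_opt vp vm = ereal (fst (theta_j N) * v)"
    by (rule mix_cost_attained)
  have "Lambda_star N (v, 0) \<le> mix_cost N mix_opt vp vm"
    unfolding Lambda_star_def using mix by (intro Inf_lower) blast
  then have L: "Lambda_star N (v, 0) = ereal (fst (theta_j N) * v)"
    using Lambda_star_ge[of v] cost by simp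
  then have "path_mixing N (x_path v) mix_opt"
    unfolding path_mixing_def x_speed_x_path[OF v] using mix cost by metis
  moreover have "path_action N (x_path v) = ereal (fst (theta_j N))"
    using v L by (simp add: path_action_def x_speed_x_path)
  ultimately show ?thesis using v by (auto simp: F_x_def)
qed

lemma INF_path_action: "(INF p\<in>F_x. path_action N p) = ereal (fst (theta_j N))"
  using optimal_path_exists path_action_ge by (metis INF_eqI INF_greatest INF_lower antisym)

lemma optimal_path_iff: "optimal_path N p \<longleftrightarrow> p \<in> F_x \<and> path_action N p = ereal (fst (theta_j N))"
  using optimal_path_exists path_action_ge unfolding optimal_path_def by (metis antisym)

lemma path_mixing_optimal:
  assumes "optimal_path N p" "path_mixing N p \<beta>"
  shows "\<beta> = mix_opt"
proof -
  obtain v where v: "0 < v" "p = x_path v" using assms by (auto simp: optimal_path_def F_x_def)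
  have "Lambda_star N (v, 0) \<le> ereal (fst (theta_j N) * v)"
    using assms v by (intro le_times_of_divide_le) (auto simp: optimal_path_iff path_action_def x_speed_x_path)
  moreover obtain vp vm where "mixture (v, 0) \<beta> vp vm" "mix_cost N \<beta> vp vm = Lambda_star N (v, 0)"
    using assms v by (auto simp: path_mixing_def x_speed_x_path)
  ultimately show ?thesis using mix_cost_unique by metis
qed

text \<open>Some optimal path has mixing parameter \<open>mix_opt\<close>, and no optimal path has
  any other.\<close>

lemma jitter_optimal_iff:
  "(\<exists>p. jitter_path N p \<and> optimal_path N p) \<longleftrightarrow> mix_opt < 1"
  using optimal_path_exists path_mixing_optimal unfolding jitter_path_def optimal_path_iff
  by metis

text \<open>Existence for the definite description comes from \<open>mix_cost_attained\<close>,
  uniqueness from \<open>mix_cost_unique\<close>, whatever the speed.\<close>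

lemma beta_opt_eq: "beta_opt N = mix_opt"
  unfolding beta_opt_def
proof (rule the_equality)
  obtain v vp vm where v: "0 < v" and mix: "mixture (v, 0) mix_opt vp vm"
    and cost: "mix_cost N mix_opt vp vm = ereal (fst (theta_j N) * v)"
    by (rule mix_cost_attained)
  have *: "mix_cost N mix_opt vp vm / ereal v = ereal (fst (theta_j N))"
    using v by (simp add: cost)
  have "ereal (fst (theta_j N)) \<le> mix_cost N \<beta>' vp' vm' / ereal v'"
    if "0 < v'" "mixture (v', 0) \<beta>' vp' vm'" for v' \<beta>' vp' vm'
    using ereal_divide_right_mono[OF mix_cost_lower[OF that(2)], of "ereal v'"] that(1) by simp
  then show "\<exists>v1 vp vm. minimizer N v1 mix_opt vp vm"
    unfolding minimizer_def using v mix * by metis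
  fix \<beta>
  assume "\<exists>v1 vp vm. minimizer N v1 \<beta> vp vm"
  then obtain v' vp' vm' where min: "minimizer N v' \<beta> vp' vm'" by blast
  then have "mix_cost N \<beta> vp' vm' / ereal v' \<le> ereal (fst (theta_j N))"
    unfolding minimizer_def using v mix * by metis
  then have "mix_cost N \<beta> vp' vm' \<le> ereal (fst (theta_j N) * v')"
    using min by (intro le_times_of_divide_le) (auto simp: minimizer_def)
  then show "\<beta> = mix_opt" using mix_cost_unique min unfolding minimizer_def by metis
qed

end

theorem theorem2:
  fixes N :: jackson_network and l1 l2 rho2 :: real
  assumes "0 \<le> arr1 N" and "0 \<le> arr2 N"
    and "0 < serv1 N" and "0 < serv2 N" and "serv1 N \<le> serv1_star N"
    and "0 \<le> route12 N" and "route12 N \<le> 1" and "0 \<le> route21 N" and "route21 N \<le> 1"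
    and "route12 N * route21 N < 1"
    and "l1 = arr1 N + l2 * route21 N" and "l2 = arr2 N + l1 * route12 N"
    and "0 < l1" and "0 < l2"
    and "rho2 = l2 / serv2 N"
    and "rho2 < 1" and "l1 < rho2 * serv1 N + (1 - rho2) * serv1_star N"
  shows "(INF p\<in>F_x. path_action N p) = ereal (fst (theta_j N)) \<and>
    ((fst (theta_j N) < fst (theta_b N) \<and> snd (theta_j N) < snd (theta_b N))
       \<longleftrightarrow> (\<exists>p. jitter_path N p \<and> optimal_path N p)) \<and>
    ((\<exists>p. jitter_path N p \<and> optimal_path N p) \<longleftrightarrow> beta_opt N < 1) \<and>
    (beta_opt N < 1 \<longleftrightarrow> 0 < M_minus N (theta_b N)) \<and>
    (0 < M_minus N (theta_b N) \<longleftrightarrow> jitter_rho N < 1)"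
proof -
  interpret stable_network N l1 l2 rho2
    using assms by unfold_locales
  show ?thesis
    using INF_path_action theta_j_less_theta_b_iff jitter_optimal_iff beta_opt_eq mix_opt(3)
      jitter_rho_less_1_iff
    by simp
qed

end
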